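(* Suppose that $R$ is a ring and that $\sigma$ is a ring endomorphism of $R$ that fixes all idempotents of $R$. Then the following conditions are equivalent: (1) $R\propto R(\sigma)$ is left morphic; (2) $R$ is unit regular.
   Context: All rings are associative with identity. For a ring $R$ and an $(R,R)$-bimodule $M$, the trivial extension $R\propto M$ is the set of pairs $(r,m)$ with $r\in R$, $m\in M$, with componentwise addition and multiplication $(r,m)(s,n)=(rs,rn+ms)$. For a ring endomorphism $\sigma$ of $R$, $R(\sigma)$ is the $(R,R)$-bimodule which equals ${}_RR$ as a left module and has right multiplication $s\cdot r=s\sigma(r)$ for $s\in R(\sigma)$, $r\in R$. An element $a$ of a ring $S$ is left morphic if $S/Sa\cong \{x\in S: xa=0\}$ as left $S$-modules; $S$ is left morphic if every element of $S$ is left morphic. A ring $R$ is unit regular if for every $a\in R$ there is a unit $u\in R$ with $a=aua$. *)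

theory Defs
  imports "HOL-Algebra.QuotRing" "HOL-Algebra.Module"
begin

section \<open>Left modules and bimodules over a not necessarily commutative ring\<close>

text \<open>
  The library locale \<^locale>\<open>module\<close> requires a commutative ring of scalars, so we provide
  noncommutative versions on the same record type. The fields \<^const>\<open>mult\<close> and
  \<^const>\<open>one\<close> inherited by that record play no role in a module.
\<close>

locale left_module = R?: ring R + M?: abelian_group M
  for R :: "('a, 'm) ring_scheme" (structure) and M :: "('a, 'b, 'n) module_scheme" (structure) +
  assumes smult_closed:
      "\<lbrakk>r \<in> carrier R; x \<in> carrier M\<rbrakk> \<Longrightarrow> r \<odot>\<^bsub>M\<^esub> x \<in> carrier M"
    and smult_l_distr:
      "\<lbrakk>r \<in> carrier R; s \<in> carrier R; x \<in> carrier M\<rbrakk> \<Longrightarrow>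
        (r \<oplus>\<^bsub>R\<^esub> s) \<odot>\<^bsub>M\<^esub> x = r \<odot>\<^bsub>M\<^esub> x \<oplus>\<^bsub>M\<^esub> s \<odot>\<^bsub>M\<^esub> x"
    and smult_r_distr:
      "\<lbrakk>r \<in> carrier R; x \<in> carrier M; y \<in> carrier M\<rbrakk> \<Longrightarrow>
        r \<odot>\<^bsub>M\<^esub> (x \<oplus>\<^bsub>M\<^esub> y) = r \<odot>\<^bsub>M\<^esub> x \<oplus>\<^bsub>M\<^esub> r \<odot>\<^bsub>M\<^esub> y"
    and smult_assoc:
      "\<lbrakk>r \<in> carrier R; s \<in> carrier R; x \<in> carrier M\<rbrakk> \<Longrightarrow>
        (r \<otimes>\<^bsub>R\<^esub> s) \<odot>\<^bsub>M\<^esub> x = r \<odot>\<^bsub>M\<^esub> (s \<odot>\<^bsub>M\<^esub> x)"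
    and smult_one:
      "x \<in> carrier M \<Longrightarrow> \<one>\<^bsub>R\<^esub> \<odot>\<^bsub>M\<^esub> x = x"

record ('a, 'b) bimodule = "('a, 'b) module" +
  rsmult :: "['b, 'a] \<Rightarrow> 'b"

locale bimodule = left_module R M
  for R :: "('a, 'm) ring_scheme" (structure) and M :: "('a, 'b, 'n) bimodule_scheme" (structure) +
  assumes rsmult_closed:
      "\<lbrakk>x \<in> carrier M; r \<in> carrier R\<rbrakk> \<Longrightarrow> rsmult M x r \<in> carrier M"
    and rsmult_r_distr:
      "\<lbrakk>x \<in> carrier M; r \<in> carrier R; s \<in> carrier R\<rbrakk> \<Longrightarrow>
        rsmult M x (r \<oplus>\<^bsub>R\<^esub> s) = rsmult M x r \<oplus>\<^bsub>M\<^esub> rsmult M x s"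
    and rsmult_l_distr:
      "\<lbrakk>x \<in> carrier M; y \<in> carrier M; r \<in> carrier R\<rbrakk> \<Longrightarrow>
        rsmult M (x \<oplus>\<^bsub>M\<^esub> y) r = rsmult M x r \<oplus>\<^bsub>M\<^esub> rsmult M y r"
    and rsmult_assoc:
      "\<lbrakk>x \<in> carrier M; r \<in> carrier R; s \<in> carrier R\<rbrakk> \<Longrightarrow>
        rsmult M x (r \<otimes>\<^bsub>R\<^esub> s) = rsmult M (rsmult M x r) s"
    and rsmult_one:
      "x \<in> carrier M \<Longrightarrow> rsmult M x \<one>\<^bsub>R\<^esub> = x"
    and smult_rsmult:
      "\<lbrakk>r \<in> carrier R; x \<in> carrier M; s \<in> carrier R\<rbrakk> \<Longrightarrow>
        rsmult M (r \<odot>\<^bsub>M\<^esub> x) s = r \<odot>\<^bsub>M\<^esub> rsmult M x s"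

definition left_module_iso ::
    "('a, 'm) ring_scheme \<Rightarrow> ('a, 'b, 'n) module_scheme \<Rightarrow> ('a, 'c, 'k) module_scheme \<Rightarrow> ('b \<Rightarrow> 'c) set"
  where "left_module_iso R M N =
    {f \<in> iso (add_monoid M) (add_monoid N).
      \<forall>r\<in>carrier R. \<forall>x\<in>carrier M. f (r \<odot>\<^bsub>M\<^esub> x) = r \<odot>\<^bsub>N\<^esub> f x}"

definition left_module_isomorphic ::
    "('a, 'm) ring_scheme \<Rightarrow> ('a, 'b, 'n) module_scheme \<Rightarrow> ('a, 'c, 'k) module_scheme \<Rightarrow> bool"
  where "left_module_isomorphic R M N \<longleftrightarrow> left_module_iso R M N \<noteq> {}"

definition left_regular_module :: "('a, 'm) ring_scheme \<Rightarrow> ('a, 'a) module"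
  where "left_regular_module R =
    \<lparr>carrier = carrier R, mult = undefined, one = undefined,
     zero = \<zero>\<^bsub>R\<^esub>, add = (\<oplus>\<^bsub>R\<^esub>), smult = (\<otimes>\<^bsub>R\<^esub>)\<rparr>"

text \<open>
  As for multiplication in \<^const>\<open>FactRing\<close>, the union over representatives in the scalar
  multiplication is a union of equal cosets when \<open>N\<close> is a submodule of \<open>M\<close>; so
  \<open>r\<close> sends the coset of \<open>x\<close> to the coset of \<open>r x\<close>.
\<close>

definition quotient_module :: "('a, 'b, 'n) module_scheme \<Rightarrow> 'b set \<Rightarrow> ('a, 'b set) module"
  where "quotient_module M N =
    \<lparr>carrier = a_rcosets\<^bsub>M\<^esub> N, mult = undefined, one = undefined,
     zero = N, add = set_add M, smult = (\<lambda>r X. \<Union>x\<in>X. N +>\<^bsub>M\<^esub> (r \<odot>\<^bsub>M\<^esub> x))\<rparr>"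


section \<open>Morphic and unit regular rings\<close>

definition left_annihilator :: "('a, 'm) ring_scheme \<Rightarrow> 'a \<Rightarrow> 'a set"
  where "left_annihilator S a = {x \<in> carrier S. x \<otimes>\<^bsub>S\<^esub> a = \<zero>\<^bsub>S\<^esub>}"

text \<open>
  In the library, \<^const>\<open>cgenideal\<close> is \<open>S a = {s a | s \<in> S}\<close>, which for noncommutative
  \<open>S\<close> is the principal \<^emph>\<open>left\<close> ideal.
\<close>

definition left_morphic_element :: "('a, 'm) ring_scheme \<Rightarrow> 'a \<Rightarrow> bool"
  where "left_morphic_element S a \<longleftrightarrow>
    left_module_isomorphic S
      (quotient_module (left_regular_module S) (PIdl\<^bsub>S\<^esub> a))
      ((left_regular_module S)\<lparr>carrier := left_annihilator S a\<rparr>)"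

definition left_morphic_ring :: "('a, 'm) ring_scheme \<Rightarrow> bool"
  where "left_morphic_ring S \<longleftrightarrow> (\<forall>a\<in>carrier S. left_morphic_element S a)"

definition unit_regular_ring :: "('a, 'm) ring_scheme \<Rightarrow> bool"
  where "unit_regular_ring R \<longleftrightarrow>
    (\<forall>a\<in>carrier R. \<exists>u\<in>Units R. a = a \<otimes>\<^bsub>R\<^esub> u \<otimes>\<^bsub>R\<^esub> a)"


section \<open>Trivial extensions and twisted bimodules\<close>

definition trivial_extension ::
    "('a, 'm) ring_scheme \<Rightarrow> ('a, 'b, 'n) bimodule_scheme \<Rightarrow> ('a \<times> 'b) ring"
  where "trivial_extension R M =
    \<lparr>carrier = carrier R \<times> carrier M,
     mult = (\<lambda>(r, m) (s, n). (r \<otimes>\<^bsub>R\<^esub> s, r \<odot>\<^bsub>M\<^esub> n \<oplus>\<^bsub>M\<^esub> rsmult M m s)),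
     one = (\<one>\<^bsub>R\<^esub>, \<zero>\<^bsub>M\<^esub>),
     zero = (\<zero>\<^bsub>R\<^esub>, \<zero>\<^bsub>M\<^esub>),
     add = (\<lambda>(r, m) (s, n). (r \<oplus>\<^bsub>R\<^esub> s, m \<oplus>\<^bsub>M\<^esub> n))\<rparr>"

definition twisted_bimodule :: "('a, 'm) ring_scheme \<Rightarrow> ('a \<Rightarrow> 'a) \<Rightarrow> ('a, 'a) bimodule"
  where "twisted_bimodule R \<sigma> =
    \<lparr>carrier = carrier R, mult = undefined, one = undefined,
     zero = \<zero>\<^bsub>R\<^esub>, add = (\<oplus>\<^bsub>R\<^esub>),
     smult = (\<otimes>\<^bsub>R\<^esub>), rsmult = (\<lambda>s r. s \<otimes>\<^bsub>R\<^esub> \<sigma> r)\<rparr>"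


section \<open>The constructions are well defined\<close>

lemma (in ring) abelian_group_same_additive:
  assumes "carrier M = carrier R" "zero M = \<zero>" "add M = add R"
  shows "abelian_group M"
  by (rule abelian_groupI) (auto simp: assms a_ac intro: l_neg)

lemma (in ring) left_regular_module_left_module: "left_module R (left_regular_module R)"
proof -
  interpret M: abelian_group "left_regular_module R"
    by (rule abelian_group_same_additive) (auto simp: left_regular_module_def)
  show ?thesis
    by unfold_locales (auto simp: left_regular_module_def l_distr r_distr m_assoc)
qed

lemma (in ring) twisted_bimodule_bimodule:
  assumes "\<sigma> \<in> ring_hom R R"
  shows "bimodule R (twisted_bimodule R \<sigma>)"
proof -
  interpret M: abelian_group "twisted_bimodule R \<sigma>"
    by (rule abelian_group_same_additive) (auto simp: twisted_bimodule_def)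
  note h = ring_hom_memE[OF assms]
  show ?thesis
    by unfold_locales (auto simp: twisted_bimodule_def l_distr r_distr m_assoc h)
qed

lemma (in bimodule) trivial_extension_ring: "ring (trivial_extension R M)"
proof -
  have R: "ring R" and M: "abelian_group M" ..
  interpret R: ring R by (rule R)
  interpret M: abelian_group M by (rule M)
  have idem: "x = \<zero>\<^bsub>M\<^esub>" if "x \<in> carrier M" "x \<oplus>\<^bsub>M\<^esub> x = x" for x
    using M.add.r_cancel_one[of x x] that by simp
  have zl: "r \<odot>\<^bsub>M\<^esub> \<zero>\<^bsub>M\<^esub> = \<zero>\<^bsub>M\<^esub>" if "r \<in> carrier R" for r
    using smult_r_distr[OF that M.zero_closed M.zero_closed] smult_closed[OF that M.zero_closed]
    by (intro idem) simp_all
  have zr: "rsmult M \<zero>\<^bsub>M\<^esub> r = \<zero>\<^bsub>M\<^esub>" if "r \<in> carrier R" for r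
    using rsmult_l_distr[OF M.zero_closed M.zero_closed that] rsmult_closed[OF M.zero_closed that]
    by (intro idem) simp_all
  show ?thesis
  proof (rule ringI)
    show "abelian_group (trivial_extension R M)"
    proof (rule abelian_groupI)
      fix x assume "x \<in> carrier (trivial_extension R M)"
      then show "\<exists>y\<in>carrier (trivial_extension R M).
          y \<oplus>\<^bsub>trivial_extension R M\<^esub> x = \<zero>\<^bsub>trivial_extension R M\<^esub>"
        by (intro bexI[of _ "(\<ominus>\<^bsub>R\<^esub> fst x, \<ominus>\<^bsub>M\<^esub> snd x)"])
          (auto simp: trivial_extension_def R.l_neg M.l_neg)
    qed (auto simp: trivial_extension_def R.a_ac M.a_ac)
    show "monoid (trivial_extension R M)"
      by (rule monoidI)
        (auto simp: trivial_extension_def R.m_assoc smult_closed rsmult_closed smult_one rsmult_one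
          zl zr smult_assoc rsmult_assoc smult_rsmult smult_r_distr rsmult_l_distr M.a_assoc)
  qed (auto simp: trivial_extension_def R.l_distr R.r_distr smult_closed rsmult_closed
         smult_l_distr smult_r_distr rsmult_l_distr rsmult_r_distr M.a_ac)
qed

lemma (in ring)
  assumes a: "a \<in> carrier R"
  shows cgenideal_abelian_subgroup: "abelian_subgroup (PIdl a) (left_regular_module R)"
    and left_annihilator_left_module:
      "left_module R ((left_regular_module R)\<lparr>carrier := left_annihilator R a\<rparr>)"
proof -
  interpret M: abelian_group "left_regular_module R"
    by (rule abelian_group_same_additive) (auto simp: left_regular_module_def)
  have inv: "inv\<^bsub>add_monoid (left_regular_module R)\<^esub> x = \<ominus> x" if "x \<in> carrier R" for x
  proof -
    have "\<ominus>\<^bsub>left_regular_module R\<^esub> x = \<ominus> x"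
      by (rule M.minus_equality) (use that in \<open>simp_all add: left_regular_module_def l_neg\<close>)
    then show ?thesis by (simp add: a_inv_def)
  qed
  have "subgroup (PIdl a) (add_monoid (left_regular_module R))"
  proof (rule group.subgroupI[OF M.a_group])
    show "PIdl a \<subseteq> carrier (add_monoid (left_regular_module R))"
      using a by (auto simp: cgenideal_def left_regular_module_def)
    show "PIdl a \<noteq> {}" by (auto simp: cgenideal_def)
  next
    fix x assume "x \<in> PIdl a"
    then obtain r where r: "r \<in> carrier R" "x = r \<otimes> a" by (auto simp: cgenideal_def)
    then have "\<ominus> x = (\<ominus> r) \<otimes> a" using a by (simp add: l_minus)
    then show "inv\<^bsub>add_monoid (left_regular_module R)\<^esub> x \<in> PIdl a"
      using r a by (auto simp: inv cgenideal_def)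
  next
    fix x y assume "x \<in> PIdl a" "y \<in> PIdl a"
    then obtain r s where "r \<in> carrier R" "x = r \<otimes> a" "s \<in> carrier R" "y = s \<otimes> a"
      by (auto simp: cgenideal_def)
    then have "x \<oplus> y = (r \<oplus> s) \<otimes> a" "r \<oplus> s \<in> carrier R" using a by (auto simp: l_distr)
    then show "x \<otimes>\<^bsub>add_monoid (left_regular_module R)\<^esub> y \<in> PIdl a"
      by (auto simp: cgenideal_def left_regular_module_def)
  qed
  then show "abelian_subgroup (PIdl a) (left_regular_module R)"
    by (intro abelian_subgroupI3 additive_subgroupI M.abelian_group_axioms)
  let ?N = "(left_regular_module R)\<lparr>carrier := left_annihilator R a\<rparr>"
  interpret N: abelian_group ?N
  proof (rule abelian_groupI)
    fix x assume x: "x \<in> carrier ?N"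
    then show "\<exists>y\<in>carrier ?N. y \<oplus>\<^bsub>?N\<^esub> x = \<zero>\<^bsub>?N\<^esub>"
      using a by (intro bexI[of _ "\<ominus> x"])
        (auto simp: left_annihilator_def left_regular_module_def l_minus l_neg)
  qed (use a in \<open>auto simp: left_annihilator_def left_regular_module_def l_distr a_ac\<close>)
  show "left_module R ?N"
    using a by unfold_locales
      (auto simp: left_annihilator_def left_regular_module_def l_distr r_distr m_assoc)
qed

lemma (in ring)
  assumes a: "a \<in> carrier R"
  shows quotient_module_smult_coset:
      "\<lbrakk>r \<in> carrier R; x \<in> carrier R\<rbrakk> \<Longrightarrow>
        r \<odot>\<^bsub>quotient_module (left_regular_module R) (PIdl a)\<^esub> (PIdl a +>\<^bsub>left_regular_module R\<^esub> x)
          = PIdl a +>\<^bsub>left_regular_module R\<^esub> (r \<otimes> x)"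
    and quotient_module_left_module:
      "left_module R (quotient_module (left_regular_module R) (PIdl a))"
proof -
  let ?M = "left_regular_module R" and ?I = "PIdl a"
  let ?Q = "quotient_module ?M ?I"
  interpret I: abelian_subgroup ?I ?M by (rule cgenideal_abelian_subgroup[OF a])
  have M [simp]: "carrier ?M = carrier R" "add ?M = add R" "smult ?M = mult R" "zero ?M = \<zero>"
    by (auto simp: left_regular_module_def)
  have Isub: "i \<in> carrier R" if "i \<in> ?I" for i
    using that a by (auto simp: cgenideal_def)
  have Il: "r \<otimes> i \<in> ?I" if "r \<in> carrier R" "i \<in> ?I" for r i
    using that a by (auto simp: cgenideal_def m_assoc[symmetric])
  have sm: "r \<odot>\<^bsub>?Q\<^esub> (?I +>\<^bsub>?M\<^esub> x) = ?I +>\<^bsub>?M\<^esub> (r \<otimes> x)"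
    if r: "r \<in> carrier R" and x: "x \<in> carrier R" for r x
  proof -
    have "?I +>\<^bsub>?M\<^esub> (r \<otimes> y) = ?I +>\<^bsub>?M\<^esub> (r \<otimes> x)" if "y \<in> ?I +>\<^bsub>?M\<^esub> x" for y
    proof -
      from that obtain i where i: "i \<in> ?I" "y = i \<oplus> x" by (auto simp: a_r_coset_def')
      then have "r \<otimes> y = r \<otimes> i \<oplus> r \<otimes> x" using r x Isub by (simp add: r_distr)
      then have "r \<otimes> y \<in> ?I +>\<^bsub>?M\<^esub> (r \<otimes> x)" using Il[OF r i(1)] by (auto simp: a_r_coset_def')
      then show ?thesis using I.a_repr_independence'[of "r \<otimes> y" "r \<otimes> x"] r x by simp
    qed
    moreover have "x \<in> ?I +>\<^bsub>?M\<^esub> x" using I.a_rcos_self[of x] x by simp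
    ultimately have "(\<Union>y\<in>?I +>\<^bsub>?M\<^esub> x. ?I +>\<^bsub>?M\<^esub> (r \<otimes> y)) = ?I +>\<^bsub>?M\<^esub> (r \<otimes> x)"
      by blast
    then show ?thesis by (simp add: quotient_module_def)
  qed
  then show "\<lbrakk>r \<in> carrier R; x \<in> carrier R\<rbrakk> \<Longrightarrow>
        r \<odot>\<^bsub>?Q\<^esub> (?I +>\<^bsub>?M\<^esub> x) = ?I +>\<^bsub>?M\<^esub> (r \<otimes> x)" for r x .
  have ad: "(?I +>\<^bsub>?M\<^esub> x) \<oplus>\<^bsub>?Q\<^esub> (?I +>\<^bsub>?M\<^esub> y) = ?I +>\<^bsub>?M\<^esub> (x \<oplus> y)"
    if "x \<in> carrier R" "y \<in> carrier R" for x y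
    using I.a_rcos_sum[of x y] that by (simp add: quotient_module_def)
  have Q: "X \<in> carrier ?Q \<longleftrightarrow> (\<exists>x\<in>carrier R. X = ?I +>\<^bsub>?M\<^esub> x)" for X
    by (auto simp: quotient_module_def A_RCOSETS_def')
  have "\<zero> \<in> ?I" using a by (auto simp: cgenideal_def intro!: exI[of _ "\<zero>"])
  then have z: "\<zero>\<^bsub>?Q\<^esub> = ?I +>\<^bsub>?M\<^esub> \<zero>"
    using Isub by (force simp: quotient_module_def a_r_coset_def')
  interpret Q: abelian_group ?Q
  proof (rule abelian_groupI)
    fix X assume "X \<in> carrier ?Q"
    then obtain x where "x \<in> carrier R" "X = ?I +>\<^bsub>?M\<^esub> x" by (auto simp: Q)
    then show "\<exists>Y\<in>carrier ?Q. Y \<oplus>\<^bsub>?Q\<^esub> X = \<zero>\<^bsub>?Q\<^esub>"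
      by (intro bexI[of _ "?I +>\<^bsub>?M\<^esub> (\<ominus> x)"]) (auto simp: Q ad z l_neg)
  qed (auto simp: Q ad z a_ac)
  show "left_module R ?Q"
    by unfold_locales (auto simp: Q sm ad l_distr r_distr m_assoc)
qed

end

theory Submission
  imports Defs
begin

text \<open>
  An element \<open>a\<close> of a ring \<open>S\<close> is left morphic iff some \<open>b\<close> satisfies \<open>S a = l(b)\<close> and
  \<open>S b = l(a)\<close>, where \<open>l\<close> denotes the left annihilator.

  If the trivial extension is left morphic, let \<open>(b, c)\<close> be such a partner of \<open>(0, a)\<close>. Comparing
  components gives \<open>R a = l(\<sigma> b)\<close>, \<open>R b = l(a)\<close> and \<open>R = l(b) c \<oplus> R \<sigma>(b)\<close> with \<open>r \<mapsto> r c\<close>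
  injective on \<open>l(b)\<close>. Hence \<open>\<sigma> b\<close>, and therefore \<open>a\<close>, is von Neumann regular. As \<open>a\<close> was arbitrary,
  \<open>b\<close> is regular too, and since \<open>\<sigma>\<close> fixes the idempotent \<open>b x\<close> belonging to \<open>b = b x b\<close> we get
  \<open>l(\<sigma> b) = l(b)\<close>. So \<open>a\<close> and \<open>b\<close> are partners in \<open>R\<close>, and if \<open>z\<close> is a reflexive inverse of \<open>a\<close>
  then \<open>z + b\<close> is a unit inner inverse of \<open>a\<close>.

  Conversely, let \<open>R\<close> be unit regular. Being left morphic is invariant under multiplication by
  units on either side, which reduces \<open>(a, m)\<close> to \<open>(e, l)\<close> with \<open>e\<close> idempotent and
  \<open>l \<in> (1 - e) R (1 - e)\<close>, and, by unit regularity of that corner, to \<open>(e, g)\<close> with \<open>g\<close> an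
  idempotent orthogonal to \<open>e\<close>. A partner of \<open>(e, g)\<close> is \<open>(1 - e - g, g)\<close>.
\<close>

section \<open>Left morphic elements and annihilator pairs\<close>

definition annihilator_pair :: "('a, 'm) ring_scheme \<Rightarrow> 'a \<Rightarrow> 'a \<Rightarrow> bool"
  where "annihilator_pair S a b \<longleftrightarrow>
    PIdl\<^bsub>S\<^esub> a = left_annihilator S b \<and> PIdl\<^bsub>S\<^esub> b = left_annihilator S a"

context ring
begin

lemma minus_eq_zero_iff:
  assumes "x \<in> carrier R" "y \<in> carrier R"
  shows "x \<ominus> y = \<zero> \<longleftrightarrow> x = y"
  using assms by (metis minus_eq r_neg a_inv_closed minus_equality minus_minus)

text \<open>An isomorphism out of \<open>R / R a\<close> is determined by the image \<open>b\<close>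
  of the coset of \<open>\<one>\<close>, since it sends the coset of \<open>x\<close> to
  \<open>x b\<close>. Its image is then \<open>R b\<close>, and injectivity says that
  \<open>x b = \<zero>\<close> exactly when \<open>x\<close> lies in \<open>R a\<close>. Conversely,
  right multiplication by a partner \<open>b\<close> descends to the quotient.\<close>

lemma left_morphic_element_iff:
  assumes a: "a \<in> carrier R"
  shows "left_morphic_element R a \<longleftrightarrow> (\<exists>b\<in>carrier R. annihilator_pair R a b)"
proof -
  let ?M = "left_regular_module R" and ?I = "PIdl a"
  let ?Q = "quotient_module ?M ?I" and ?A = "left_annihilator R a"
  let ?N = "?M\<lparr>carrier := ?A\<rparr>"
  let ?c = "\<lambda>x. ?I +>\<^bsub>?M\<^esub> x"
  interpret I: abelian_subgroup ?I ?M by (rule cgenideal_abelian_subgroup[OF a])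
  have M [simp]: "carrier ?M = carrier R" "add ?M = add R" "smult ?M = mult R" "zero ?M = \<zero>"
    by (auto simp: left_regular_module_def)
  have Q: "carrier ?Q = ?c ` carrier R"
    by (auto simp: quotient_module_def A_RCOSETS_def')
  have add: "?c x \<oplus>\<^bsub>?Q\<^esub> ?c y = ?c (x \<oplus> y)" if "x \<in> carrier R" "y \<in> carrier R" for x y
    using I.a_rcos_sum[of x y] that by (simp add: quotient_module_def)
  have smult: "r \<odot>\<^bsub>?Q\<^esub> ?c x = ?c (r \<otimes> x)" if "r \<in> carrier R" "x \<in> carrier R" for r x
    using quotient_module_smult_coset[OF a that] .
  have coset_eq: "?c x = ?c y \<longleftrightarrow> x \<ominus> y \<in> ?I"
    if x: "x \<in> carrier R" and y: "y \<in> carrier R" for x y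
  proof -
    have "?c x = ?c y \<longleftrightarrow> x \<in> ?c y"
      using I.a_repr_independence'[of x y] I.a_rcos_self[of x] x y by auto
    also have "\<dots> \<longleftrightarrow> (\<exists>i\<in>?I. x = i \<oplus> y)"
      by (auto simp: a_r_coset_def')
    also have "\<dots> \<longleftrightarrow> x \<ominus> y \<in> ?I"
    proof
      assume "\<exists>i\<in>?I. x = i \<oplus> y"
      then obtain i where i: "i \<in> ?I" "x = i \<oplus> y" by blast
      then have "i \<in> carrier R" using I.a_subset by auto
      with i y show "x \<ominus> y \<in> ?I" by (simp add: minus_eq a_assoc r_neg)
    next
      assume "x \<ominus> y \<in> ?I"
      moreover have "x = (x \<ominus> y) \<oplus> y" using x y by (simp add: minus_eq a_assoc l_neg)
      ultimately show "\<exists>i\<in>?I. x = i \<oplus> y" by blast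
    qed
    finally show ?thesis .
  qed
  \<comment> \<open>Every element of the quotient is a coset \<open>?c x\<close>, so the module
    isomorphism can be stated by its values on representatives.\<close>
  have iso: "left_morphic_element R a \<longleftrightarrow> (\<exists>f.
      (\<forall>x\<in>carrier R. \<forall>y\<in>carrier R. f (?c (x \<oplus> y)) = f (?c x) \<oplus> f (?c y)) \<and>
      (\<forall>r\<in>carrier R. \<forall>x\<in>carrier R. f (?c (r \<otimes> x)) = r \<otimes> f (?c x)) \<and>
      bij_betw f (?c ` carrier R) ?A)"
    unfolding left_morphic_element_def left_module_isomorphic_def left_module_iso_def ex_in_conv[symmetric]
    by (intro ex_cong1) (auto simp: iso_def hom_def Q add smult Pi_iff bij_betw_def)
  show ?thesis
  proof
    assume "left_morphic_element R a"
    then obtain f where f: "\<And>r x. r \<in> carrier R \<Longrightarrow> x \<in> carrier R \<Longrightarrow> f (?c (r \<otimes> x)) = r \<otimes> f (?c x)"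
      and bij: "bij_betw f (?c ` carrier R) ?A"
      unfolding iso by blast
    define b where "b = f (?c \<one>)"
    have bA: "b \<in> ?A" using bij by (auto simp: b_def bij_betw_def)
    then have b: "b \<in> carrier R" by (simp add: left_annihilator_def)
    have fb: "f (?c x) = x \<otimes> b" if "x \<in> carrier R" for x
      using f[OF that one_closed] that by (simp add: b_def)
    have "?A = f ` ?c ` carrier R" using bij by (simp add: bij_betw_def)
    also have "\<dots> = PIdl b" by (auto simp: image_image fb cgenideal_def[of R b] cong: image_cong)
    finally have "?A = PIdl b" .
    moreover have "x \<in> ?I \<longleftrightarrow> x \<in> left_annihilator R b" for x
    proof (cases "x \<in> carrier R")
      case True
      have "x \<in> ?I \<longleftrightarrow> ?c x = ?c \<zero>" using True by (simp add: coset_eq minus_eq)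
      also have "\<dots> \<longleftrightarrow> f (?c x) = f (?c \<zero>)"
        using bij True by (auto simp: bij_betw_def dest: inj_onD)
      finally show ?thesis using True b by (simp add: fb left_annihilator_def)
    next
      case False
      then show ?thesis using I.a_subset by (auto simp: left_annihilator_def)
    qed
    ultimately show "\<exists>b\<in>carrier R. annihilator_pair R a b"
      using b by (auto simp: annihilator_pair_def)
  next
    assume "\<exists>b\<in>carrier R. annihilator_pair R a b"
    then obtain b where b: "b \<in> carrier R"
      and I: "?I = left_annihilator R b" and A: "PIdl b = ?A"
      by (auto simp: annihilator_pair_def)
    \<comment> \<open>Right multiplication by \<open>b\<close> on a chosen representative;
      \<open>eq\<close> gives both independence of the choice and injectivity.\<close>
    define f where "f X = (SOME x. x \<in> carrier R \<and> ?c x = X) \<otimes> b" for X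
    have eq: "?c x = ?c y \<longleftrightarrow> x \<otimes> b = y \<otimes> b" if "x \<in> carrier R" "y \<in> carrier R" for x y
    proof -
      have "(x \<ominus> y) \<otimes> b = x \<otimes> b \<ominus> y \<otimes> b" using that b by (simp add: minus_eq l_distr l_minus)
      then show ?thesis using that b by (simp add: coset_eq) (simp add: I left_annihilator_def minus_eq_zero_iff)
    qed
    have fc: "f (?c x) = x \<otimes> b" if x: "x \<in> carrier R" for x
    proof -
      have "\<exists>y. y \<in> carrier R \<and> ?c y = ?c x" using x by blast
      from someI_ex[OF this] show ?thesis unfolding f_def using eq x by blast
    qed
    have "bij_betw f (?c ` carrier R) ?A"
      unfolding bij_betw_def A[symmetric]
      by (auto simp: inj_on_def fc eq cgenideal_def[of R b] image_iff)
    then show "left_morphic_element R a"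
      unfolding iso using b by (intro exI[of _ f]) (auto simp: fc l_distr m_assoc)
  qed
qed

text \<open>Here \<open>x\<close> kills \<open>inv v \<otimes> b \<otimes> inv u\<close> iff
  \<open>x \<otimes> inv v\<close> kills \<open>b\<close>, iff \<open>x \<otimes> inv v\<close> lies
  in \<open>R a\<close>, iff \<open>x\<close> lies in \<open>R a v\<close>, which is
  \<open>R (u a v)\<close>.\<close>

lemma annihilator_pair_unit_mult:
  assumes ab: "annihilator_pair R a b" and a: "a \<in> carrier R" and b: "b \<in> carrier R"
    and u: "u \<in> Units R" and v: "v \<in> Units R"
  shows "annihilator_pair R (u \<otimes> a \<otimes> v) (inv v \<otimes> b \<otimes> inv u)"
proof -
  have half: "PIdl (u \<otimes> a \<otimes> v) = left_annihilator R (inv v \<otimes> b \<otimes> inv u)"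
    if ab: "PIdl a = left_annihilator R b" and a: "a \<in> carrier R" and b: "b \<in> carrier R"
      and u: "u \<in> Units R" and v: "v \<in> Units R" for a b u v
  proof (intro Set.set_eqI iffI)
    note c = a b u v Units_closed[OF u] Units_closed[OF v] Units_inv_closed[OF u] Units_inv_closed[OF v]
    have iff: "x \<otimes> b = \<zero> \<longleftrightarrow> (\<exists>s\<in>carrier R. x = s \<otimes> a)" if "x \<in> carrier R" for x
      using ab that by (auto simp: cgenideal_def left_annihilator_def set_eq_iff)
    fix x
    {
      assume "x \<in> PIdl (u \<otimes> a \<otimes> v)"
      then obtain s where s: "s \<in> carrier R" "x = s \<otimes> (u \<otimes> a \<otimes> v)" by (auto simp: cgenideal_def)
      have "x \<otimes> (inv v \<otimes> b \<otimes> inv u) = s \<otimes> u \<otimes> a \<otimes> (v \<otimes> inv v) \<otimes> b \<otimes> inv u"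
        using s c by (simp add: m_assoc del: Units_r_inv)
      also have "\<dots> = ((s \<otimes> u) \<otimes> a) \<otimes> b \<otimes> inv u" using s c by simp
      also have "((s \<otimes> u) \<otimes> a) \<otimes> b = \<zero>" using iff[of "(s \<otimes> u) \<otimes> a"] s c by auto
      finally show "x \<in> left_annihilator R (inv v \<otimes> b \<otimes> inv u)"
        using s c by (simp add: left_annihilator_def)
    }
    assume "x \<in> left_annihilator R (inv v \<otimes> b \<otimes> inv u)"
    then have x: "x \<in> carrier R" "x \<otimes> (inv v \<otimes> b \<otimes> inv u) = \<zero>"
      by (auto simp: left_annihilator_def)
    have "(x \<otimes> inv v) \<otimes> b = x \<otimes> inv v \<otimes> b \<otimes> (inv u \<otimes> u)" using x(1) c by simp
    also have "\<dots> = (x \<otimes> (inv v \<otimes> b \<otimes> inv u)) \<otimes> u" using x(1) c by (simp add: m_assoc del: Units_l_inv)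
    also have "\<dots> = \<zero>" using x c by simp
    finally obtain s where s: "s \<in> carrier R" "x \<otimes> inv v = s \<otimes> a" using iff[of "x \<otimes> inv v"] x c by auto
    have "x = x \<otimes> inv v \<otimes> v" using x(1) c by (simp add: m_assoc)
    also have "\<dots> = s \<otimes> (inv u \<otimes> u) \<otimes> a \<otimes> v" using s c by simp
    also have "\<dots> = (s \<otimes> inv u) \<otimes> (u \<otimes> a \<otimes> v)" using s c by (simp add: m_assoc del: Units_l_inv)
    finally show "x \<in> PIdl (u \<otimes> a \<otimes> v)" using s c unfolding cgenideal_def by blast
  qed
  \<comment> \<open>The second equality is \<open>half\<close> with \<open>a\<close> and
    \<open>b\<close> exchanged and \<open>inv v\<close>, \<open>inv u\<close> in place of
    \<open>u\<close>, \<open>v\<close>.\<close>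
  have "PIdl (inv v \<otimes> b \<otimes> inv u) = left_annihilator R (inv (inv u) \<otimes> a \<otimes> inv (inv v))"
    using ab a b u v by (intro half) (auto simp: annihilator_pair_def)
  then show ?thesis using half[of a b u v] ab a b u v by (simp add: annihilator_pair_def)
qed

lemma left_morphic_element_unit_mult:
  assumes ua: "left_morphic_element R (u \<otimes> a \<otimes> v)" and a: "a \<in> carrier R"
    and u: "u \<in> Units R" and v: "v \<in> Units R"
  shows "left_morphic_element R a"
proof -
  note c = a u v Units_closed[OF u] Units_closed[OF v] Units_inv_closed[OF u] Units_inv_closed[OF v]
  obtain b where b: "b \<in> carrier R" "annihilator_pair R (u \<otimes> a \<otimes> v) b"
    using ua left_morphic_element_iff[of "u \<otimes> a \<otimes> v"] c by auto
  have "inv u \<otimes> (u \<otimes> a \<otimes> v) \<otimes> inv v = (inv u \<otimes> u) \<otimes> a \<otimes> (v \<otimes> inv v)"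
    using c by (simp add: m_assoc del: Units_l_inv Units_r_inv)
  then have "inv u \<otimes> (u \<otimes> a \<otimes> v) \<otimes> inv v = a" using c by simp
  with annihilator_pair_unit_mult[OF b(2) _ b(1), of "inv u" "inv v"] c
  have "annihilator_pair R a (v \<otimes> b \<otimes> u)" by simp
  then show ?thesis using left_morphic_element_iff[OF a] b c by auto
qed

section \<open>Unit inner inverses: from partners, and in corners\<close>

text \<open>While \<open>a\<close> and \<open>z\<close> are mutually inverse between the idempotents
  \<open>a z\<close> and \<open>z a\<close>, the partner \<open>b\<close> and a suitable
  \<open>w\<close> are so between the complements \<open>p\<close> and \<open>q\<close>. The mixed
  products vanish, so the sums \<open>a \<oplus> w\<close> and \<open>z \<oplus> b\<close> are
  inverse to each other.\<close>

lemma annihilator_pair_imp_unit_regular: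
  assumes ab: "annihilator_pair R a b"
    and a: "a \<in> carrier R" and b: "b \<in> carrier R" and y: "y \<in> carrier R"
    and aya: "a \<otimes> y \<otimes> a = a"
  shows "\<exists>u\<in>Units R. a = a \<otimes> u \<otimes> a"
proof -
  have la: "x \<otimes> a = \<zero> \<longleftrightarrow> (\<exists>s\<in>carrier R. x = s \<otimes> b)"
    and lb: "x \<otimes> b = \<zero> \<longleftrightarrow> (\<exists>s\<in>carrier R. x = s \<otimes> a)" if "x \<in> carrier R" for x
    using ab that by (auto simp: annihilator_pair_def cgenideal_def left_annihilator_def set_eq_iff)
  have ab0: "a \<otimes> b = \<zero>" using lb[OF a] a by (metis l_one one_closed)
  have ba0: "b \<otimes> a = \<zero>" using la[OF b] b by (metis l_one one_closed)
  define z where "z = y \<otimes> a \<otimes> y"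
  have z: "z \<in> carrier R" using a y by (simp add: z_def)
  have aza: "a \<otimes> z \<otimes> a = a" using a y aya by (simp add: z_def flip: m_assoc)
  have zaz: "z \<otimes> a \<otimes> z = z"
  proof -
    have "z \<otimes> a \<otimes> z = y \<otimes> (a \<otimes> y \<otimes> a) \<otimes> y \<otimes> a \<otimes> y" using a y by (simp add: z_def m_assoc)
    also have "\<dots> = y \<otimes> a \<otimes> y \<otimes> a \<otimes> y" by (simp only: aya)
    also have "\<dots> = y \<otimes> (a \<otimes> y \<otimes> a) \<otimes> y" using a y by (simp add: m_assoc)
    finally show ?thesis using aya by (simp add: z_def)
  qed
  define p q where "p = \<one> \<ominus> a \<otimes> z" and "q = \<one> \<ominus> z \<otimes> a"
  have pq: "p \<in> carrier R" "q \<in> carrier R" using a z by (auto simp: p_def q_def)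
  have pa: "p \<otimes> a = \<zero>" using a z aza by (simp add: p_def minus_eq l_distr l_minus r_neg)
  have zp: "z \<otimes> p = \<zero>" using a z zaz by (simp add: p_def minus_eq r_distr r_minus r_neg flip: m_assoc)
  have aq: "a \<otimes> q = \<zero>" using a z aza by (simp add: q_def minus_eq r_distr r_minus r_neg flip: m_assoc)
  have qz: "q \<otimes> z = \<zero>" using a z zaz by (simp add: q_def minus_eq l_distr l_minus r_neg)
  have qb: "q \<otimes> b = b" using a b z ab0 by (simp add: q_def minus_eq l_distr l_minus m_assoc)
  have bp: "b \<otimes> p = b" using a b z ba0 by (simp add: p_def minus_eq r_distr r_minus flip: m_assoc)
  have pp: "p \<otimes> p = p"
    using a z pa pq(1) by (subst (2) p_def) (simp add: minus_eq r_distr r_minus flip: m_assoc)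
  obtain w0 where w0: "w0 \<in> carrier R" "p = w0 \<otimes> b" using la[OF pq(1)] pa by auto
  \<comment> \<open>Trimming \<open>w0\<close> into \<open>p R q\<close> forces
    \<open>w z = z w = \<zero>\<close>, and \<open>w b = p\<close> survives because
    \<open>q b = b\<close> and \<open>p p = p\<close>.\<close>
  define w where "w = p \<otimes> w0 \<otimes> q"
  have w: "w \<in> carrier R" using pq w0 by (simp add: w_def)
  have wb: "w \<otimes> b = p"
  proof -
    have "w \<otimes> b = p \<otimes> (w0 \<otimes> (q \<otimes> b))" using pq w0(1) b by (simp add: w_def m_assoc)
    then show ?thesis using pp qb w0(2) by simp
  qed
  have wz: "w \<otimes> z = \<zero>" using pq w0(1) z qz by (simp add: w_def m_assoc)
  have zw: "z \<otimes> w = \<zero>" using pq w0(1) z zp by (simp add: w_def flip: m_assoc)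
  have qq: "q \<otimes> q = q"
    using a z aq pq(2) by (subst (1) q_def) (simp add: minus_eq l_distr l_minus m_assoc)
  then have wq: "w \<otimes> q = w" using pq w0(1) by (simp add: w_def m_assoc)
  \<comment> \<open>The difference \<open>b w - q\<close> kills \<open>b\<close>, so it lies in
    \<open>R a\<close>. It is also unchanged by right multiplication by \<open>q\<close>, which
    annihilates \<open>R a\<close>.\<close>
  have bw: "b \<otimes> w = q"
  proof -
    have "(b \<otimes> w \<ominus> q) \<otimes> b = \<zero>"
      using b w pq wb bp qb by (simp add: minus_eq l_distr l_minus m_assoc r_neg)
    then obtain s where s: "s \<in> carrier R" "b \<otimes> w \<ominus> q = s \<otimes> a"
      using lb[of "b \<otimes> w \<ominus> q"] b w pq by auto
    have "b \<otimes> w \<ominus> q = (b \<otimes> w \<ominus> q) \<otimes> q"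
      using b w pq wq qq by (simp add: minus_eq l_distr l_minus m_assoc)
    also have "\<dots> = \<zero>" unfolding s(2) using s(1) a pq aq by (simp add: m_assoc)
    finally show ?thesis using b w pq by (simp add: minus_eq_zero_iff)
  qed
  have "(z \<oplus> b) \<otimes> (a \<oplus> w) = z \<otimes> a \<oplus> q"
    using a b w z pq bw ba0 zw by (simp add: l_distr r_distr)
  also have "\<dots> = \<one>" using a z unfolding q_def by algebra
  finally have 1: "(z \<oplus> b) \<otimes> (a \<oplus> w) = \<one>" .
  have "(a \<oplus> w) \<otimes> (z \<oplus> b) = a \<otimes> z \<oplus> p"
    using a b w z pq wb ab0 wz by (simp add: l_distr r_distr)
  also have "\<dots> = \<one>" using a z unfolding p_def by algebra
  finally have 2: "(a \<oplus> w) \<otimes> (z \<oplus> b) = \<one>" .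
  have "z \<oplus> b \<in> Units R" using 1 2 a b w z by (auto simp: Units_def)
  moreover have "a \<otimes> (z \<oplus> b) \<otimes> a = a"
    using a b z aza ab0 by (simp add: l_distr r_distr)
  ultimately show ?thesis by metis
qed

text \<open>
  The corner ring \<open>f R f\<close> with \<open>f = 1 - e\<close> inherits unit regularity: if \<open>w\<close> is a unit inner
  inverse of \<open>e + m\<close>, then the Schur complement of \<open>e w e = e\<close> in \<open>w\<close> is a unit inner inverse
  of \<open>m\<close> in \<open>f R f\<close>. Here \<open>v\<close> is \<open>e\<close> plus this Schur complement.
\<close>

lemma unit_regular_corner:
  assumes ur: "unit_regular_ring R" and e: "e \<in> carrier R" "e \<otimes> e = e"
    and m: "m \<in> carrier R" "e \<otimes> m = \<zero>" "m \<otimes> e = \<zero>"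
  shows "\<exists>v\<in>Units R. e \<otimes> v = e \<and> v \<otimes> e = e \<and> m \<otimes> v \<otimes> m = m"
proof -
  obtain w where wU: "w \<in> Units R" and w1: "(e \<oplus> m) \<otimes> w \<otimes> (e \<oplus> m) = e \<oplus> m"
    using ur e m unfolding unit_regular_ring_def by (metis a_closed)
  have w: "w \<in> carrier R" using wU by (rule Units_closed)
  \<comment> \<open>Multiplying \<open>w1\<close> by \<open>e\<close> on either side splits it into
    four equations, \<open>ewe\<close>, \<open>mwe\<close>, \<open>ewm\<close> and
    \<open>mwm\<close>.\<close>
  have "e \<otimes> ((e \<oplus> m) \<otimes> w \<otimes> (e \<oplus> m)) = e"
    unfolding w1 using e m by (simp add: r_distr)
  moreover have "e \<otimes> ((e \<oplus> m) \<otimes> w \<otimes> (e \<oplus> m)) = (e \<otimes> (e \<oplus> m)) \<otimes> w \<otimes> (e \<oplus> m)"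
    using e m w by (simp add: m_assoc)
  moreover have "e \<otimes> (e \<oplus> m) = e" using e m by (simp add: r_distr)
  ultimately have A: "e \<otimes> w \<otimes> (e \<oplus> m) = e" by simp
  have "e \<otimes> w \<otimes> (e \<oplus> m) \<oplus> m \<otimes> w \<otimes> (e \<oplus> m) = e \<oplus> m"
    using w1 e m w by (simp add: l_distr)
  then have B: "m \<otimes> w \<otimes> (e \<oplus> m) = m" unfolding A using e m w by simp
  have ee: "(e \<oplus> m) \<otimes> e = e" using e m by (simp add: l_distr)
  have ewe: "e \<otimes> w \<otimes> e = e"
    using arg_cong[OF A, of "\<lambda>x. x \<otimes> e"] e m w ee by (simp add: m_assoc)
  have mwe: "m \<otimes> w \<otimes> e = \<zero>"
    using arg_cong[OF B, of "\<lambda>x. x \<otimes> e"] e m w ee by (simp add: m_assoc)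
  have ewm: "e \<otimes> w \<otimes> m = \<zero>" using A ewe e m w by (simp add: r_distr)
  have mwm: "m \<otimes> w \<otimes> m = m" using B mwe e m w by (simp add: r_distr)
  \<comment> \<open>These are the off-diagonal Peirce components of \<open>w\<close>, in
    \<open>e R (1 - e)\<close> and \<open>(1 - e) R e\<close>. Both square to zero, so
    \<open>\<one> \<ominus> p\<close> and \<open>\<one> \<ominus> q\<close> are units; they clear
    row and column \<open>e\<close> of \<open>w\<close>. As \<open>p m = m q = \<zero>\<close>, they
    do not affect \<open>m w m\<close>.\<close>
  define p q where "p = e \<otimes> w \<ominus> e" and "q = w \<otimes> e \<ominus> e"
  have pq: "p \<in> carrier R" "q \<in> carrier R" using e w by (auto simp: p_def q_def)
  have pe: "p \<otimes> e = \<zero>" using e w ewe by (simp add: p_def minus_eq l_distr l_minus r_neg)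
  have eq: "e \<otimes> q = \<zero>" using e w ewe by (simp add: q_def minus_eq r_distr r_minus r_neg flip: m_assoc)
  have ep: "e \<otimes> p = p" using e w by (simp add: p_def minus_eq r_distr r_minus flip: m_assoc)
  have qe: "q \<otimes> e = q" using e w by (simp add: q_def minus_eq l_distr l_minus m_assoc)
  have pp: "p \<otimes> p = \<zero>" using ep pe pq e by (metis m_assoc l_null)
  have qq: "q \<otimes> q = \<zero>" using qe eq pq e by (metis m_assoc r_null)
  have pm: "p \<otimes> m = \<zero>" using e w m ewm by (simp add: p_def minus_eq l_distr l_minus)
  have mq: "m \<otimes> q = \<zero>" using e w m mwe by (simp add: q_def minus_eq r_distr r_minus flip: m_assoc)
  have unit: "\<one> \<ominus> x \<in> Units R" if x: "x \<in> carrier R" "x \<otimes> x = \<zero>" for x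
  proof -
    have "(\<one> \<ominus> x) \<otimes> (\<one> \<oplus> x) = \<one>" "(\<one> \<oplus> x) \<otimes> (\<one> \<ominus> x) = \<one>"
      using x by (simp_all add: minus_eq l_distr r_distr l_minus r_minus a_assoc r_neg l_neg)
    then show ?thesis using x(1) by (auto simp: Units_def intro!: bexI[of _ "\<one> \<oplus> x"])
  qed
  define v where "v = (\<one> \<ominus> q) \<otimes> w \<otimes> (\<one> \<ominus> p)"
  have "v \<in> Units R" unfolding v_def using unit pq pp qq wU by (intro Units_m_closed) auto
  moreover have "e \<otimes> v = e"
  proof -
    have "e \<otimes> v = e \<otimes> (\<one> \<ominus> q) \<otimes> w \<otimes> (\<one> \<ominus> p)" using e w pq by (simp add: v_def m_assoc)
    also have "e \<otimes> (\<one> \<ominus> q) = e" using e pq eq by (simp add: minus_eq r_distr r_minus)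
    also have "e \<otimes> w = e \<oplus> p" using e w unfolding p_def by algebra
    also have "(e \<oplus> p) \<otimes> (\<one> \<ominus> p) = e"
      using e pq ep pp by (simp add: minus_eq l_distr r_distr r_minus a_assoc r_neg l_neg)
    finally show ?thesis .
  qed
  moreover have "v \<otimes> e = e"
  proof -
    have "v \<otimes> e = (\<one> \<ominus> q) \<otimes> (w \<otimes> ((\<one> \<ominus> p) \<otimes> e))" using e w pq by (simp add: v_def m_assoc)
    also have "(\<one> \<ominus> p) \<otimes> e = e" using e pq pe by (simp add: minus_eq l_distr l_minus)
    also have "w \<otimes> e = e \<oplus> q" using e w unfolding q_def by algebra
    also have "(\<one> \<ominus> q) \<otimes> (e \<oplus> q) = e"
      using e pq qe qq by (simp add: minus_eq l_distr r_distr l_minus a_assoc r_neg l_neg)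
    finally show ?thesis .
  qed
  moreover have "m \<otimes> v \<otimes> m = m"
  proof -
    have "m \<otimes> v \<otimes> m = (m \<otimes> (\<one> \<ominus> q)) \<otimes> w \<otimes> ((\<one> \<ominus> p) \<otimes> m)"
      using m w pq by (simp add: v_def m_assoc)
    also have "m \<otimes> (\<one> \<ominus> q) = m" using m pq mq by (simp add: minus_eq r_distr r_minus)
    also have "(\<one> \<ominus> p) \<otimes> m = m" using m pq pm by (simp add: minus_eq l_distr l_minus)
    finally show ?thesis using mwm by simp
  qed
  ultimately show ?thesis by blast
qed

end

section \<open>The trivial extension by the twisted bimodule\<close>

locale twisted_extension = ring R for R :: "('a, 'm) ring_scheme" (structure) +
  fixes \<sigma> :: "'a \<Rightarrow> 'a" and S
  defines "S \<equiv> trivial_extension R (twisted_bimodule R \<sigma>)"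
  assumes hom: "\<sigma> \<in> ring_hom R R"
    and fixes_idem: "\<And>e. e \<in> carrier R \<Longrightarrow> e \<otimes> e = e \<Longrightarrow> \<sigma> e = e"
begin

lemma S_simps [simp]:
  "carrier S = carrier R \<times> carrier R"
  "(r, m) \<otimes>\<^bsub>S\<^esub> (s, n) = (r \<otimes> s, r \<otimes> n \<oplus> m \<otimes> \<sigma> s)"
  "\<one>\<^bsub>S\<^esub> = (\<one>, \<zero>)" "\<zero>\<^bsub>S\<^esub> = (\<zero>, \<zero>)"
  by (auto simp: S_def trivial_extension_def twisted_bimodule_def)

lemma sigma_simps [simp]:
  "x \<in> carrier R \<Longrightarrow> \<sigma> x \<in> carrier R" "\<sigma> \<one> = \<one>" "\<sigma> \<zero> = \<zero>"
  "\<lbrakk>x \<in> carrier R; y \<in> carrier R\<rbrakk> \<Longrightarrow> \<sigma> (x \<otimes> y) = \<sigma> x \<otimes> \<sigma> y"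
  using ring_hom_memE[OF hom] fixes_idem[of \<zero>] by auto

lemma S_ring: "ring S"
  unfolding S_def by (rule bimodule.trivial_extension_ring[OF twisted_bimodule_bimodule[OF hom]])

interpretation S: ring S by (rule S_ring)

lemma mem_PIdl_S:
  "x \<in> PIdl\<^bsub>S\<^esub> y \<longleftrightarrow> (\<exists>s\<in>carrier R. \<exists>t\<in>carrier R. x = (s, t) \<otimes>\<^bsub>S\<^esub> y)"
  by (auto simp: cgenideal_def simp del: S_simps(2))

section \<open>From unit regular to left morphic\<close>

lemma annihilator_pair_idempotents:
  assumes c: "e \<in> carrier R" "g \<in> carrier R" "h \<in> carrier R" and sum: "e \<oplus> g \<oplus> h = \<one>"
    and idem: "e \<otimes> e = e" "g \<otimes> g = g" "h \<otimes> h = h"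
    and orth: "e \<otimes> g = \<zero>" "g \<otimes> e = \<zero>" "e \<otimes> h = \<zero>" "h \<otimes> e = \<zero>" "g \<otimes> h = \<zero>" "h \<otimes> g = \<zero>"
  shows "annihilator_pair S (e, g) (h, g)"
proof -
  \<comment> \<open>The assumptions are symmetric in \<open>e\<close> and \<open>h\<close>, so this
    equality also yields the other one.\<close>
  have half: "PIdl\<^bsub>S\<^esub> (e, g) = left_annihilator S (h, g)"
    if c: "e \<in> carrier R" "g \<in> carrier R" "h \<in> carrier R" and sum: "e \<oplus> g \<oplus> h = \<one>"
    and idem: "e \<otimes> e = e" "g \<otimes> g = g" "h \<otimes> h = h"
    and orth: "e \<otimes> g = \<zero>" "g \<otimes> e = \<zero>" "e \<otimes> h = \<zero>" "g \<otimes> h = \<zero>" for e g h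
  proof (intro Set.set_eqI iffI)
    have fix_eh: "\<sigma> e = e" "\<sigma> h = h" using c idem fixes_idem by auto
    fix x
    {
      assume "x \<in> PIdl\<^bsub>S\<^esub> (e, g)"
      then obtain s t where st: "s \<in> carrier R" "t \<in> carrier R" "x = (s, t) \<otimes>\<^bsub>S\<^esub> (e, g)"
        by (auto simp: mem_PIdl_S)
      then have "x \<otimes>\<^bsub>S\<^esub> (h, g) = (s, t) \<otimes>\<^bsub>S\<^esub> ((e, g) \<otimes>\<^bsub>S\<^esub> (h, g))"
        using c S.m_assoc[of "(s, t)" "(e, g)" "(h, g)"] by simp
      also have "\<dots> = \<zero>\<^bsub>S\<^esub>" using st c fix_eh orth by simp
      finally show "x \<in> left_annihilator S (h, g)"
        using st c by (simp add: left_annihilator_def)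
    }
    assume "x \<in> left_annihilator S (h, g)"
    then obtain r n where x: "x = (r, n)" and rn: "r \<in> carrier R" "n \<in> carrier R"
      and rh: "r \<otimes> h = \<zero>" and rg_nh: "r \<otimes> g \<oplus> n \<otimes> h = \<zero>"
      by (auto simp: left_annihilator_def fix_eh)
    \<comment> \<open>Right multiplication by \<open>h\<close> removes \<open>r g\<close> and keeps
      \<open>n h\<close>, which separates the two terms of \<open>rg_nh\<close>.\<close>
    have nh: "n \<otimes> h = \<zero>"
      using arg_cong[OF rg_nh, of "\<lambda>x. x \<otimes> h"] rn c idem orth by (simp add: l_distr m_assoc)
    have rg: "r \<otimes> g = \<zero>" using rg_nh nh rn c by simp
    have r: "r \<otimes> e = r"
      using arg_cong[OF sum, of "\<lambda>x. r \<otimes> x"] rn c rh rg by (simp add: r_distr)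
    have n: "n \<otimes> g \<oplus> n \<otimes> e = n"
      using arg_cong[OF sum, of "\<lambda>x. n \<otimes> x"] rn c nh by (simp add: r_distr a_comm)
    \<comment> \<open>The second coordinate of the factor contributes \<open>n e\<close>; the
      missing \<open>n g\<close> comes from the summand \<open>n g\<close> of the first, invisible
      in the first component since \<open>g e = \<zero>\<close>.\<close>
    have "x = (r \<oplus> n \<otimes> g, n) \<otimes>\<^bsub>S\<^esub> (e, g)"
      using rn c r n rg idem orth by (simp add: x fix_eh l_distr m_assoc)
    then show "x \<in> PIdl\<^bsub>S\<^esub> (e, g)" using rn c unfolding mem_PIdl_S by blast
  qed
  have "h \<oplus> g \<oplus> e = \<one>" using sum c by (simp add: a_ac)
  then show ?thesis
    unfolding annihilator_pair_def using half[of e g h] half[of h g e] assms by simp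
qed

lemma Units_S_diag:
  assumes "u \<in> Units R"
  shows "(u, \<zero>) \<in> Units S"
proof -
  have "(inv u, \<zero>) \<otimes>\<^bsub>S\<^esub> (u, \<zero>) = \<one>\<^bsub>S\<^esub>" "(u, \<zero>) \<otimes>\<^bsub>S\<^esub> (inv u, \<zero>) = \<one>\<^bsub>S\<^esub>"
    using assms by (simp_all add: Units_closed)
  moreover have "(u, \<zero>) \<in> carrier S" "(inv u, \<zero>) \<in> carrier S"
    using assms by (simp_all add: Units_closed)
  ultimately show ?thesis unfolding Units_def by blast
qed

lemma Units_S_unipotent: "n \<in> carrier R \<Longrightarrow> (\<one>, n) \<in> Units S"
  unfolding Units_def by (auto intro!: bexI[of _ "\<ominus> n"] simp: l_neg r_neg)

lemma left_morphic_S: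
  assumes ur: "unit_regular_ring R"
  shows "left_morphic_ring S"
  unfolding left_morphic_ring_def
proof
  fix \<alpha> assume "\<alpha> \<in> carrier S"
  then obtain a m where \<alpha>: "\<alpha> = (a, m)" and am: "a \<in> carrier R" "m \<in> carrier R" by auto
  obtain u where uU: "u \<in> Units R" and aua: "a \<otimes> u \<otimes> a = a"
    using ur am unfolding unit_regular_ring_def by metis
  have u: "u \<in> carrier R" using uU by (rule Units_closed)
  define e where "e = u \<otimes> a"
  define n where "n = u \<otimes> m"
  have c: "e \<in> carrier R" "n \<in> carrier R" using u am by (auto simp: e_def n_def)
  have ee: "e \<otimes> e = e" using u am aua by (simp add: e_def m_assoc)
  have se: "\<sigma> e = e" using c ee fixes_idem by blast
  \<comment> \<open>Left multiplication by \<open>(\<one>, \<ominus> n)\<close> turns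
    \<open>(e, n)\<close> into \<open>(e, k)\<close>, as \<open>\<sigma> e = e\<close>; right
    multiplication by \<open>(\<one>, \<ominus> k)\<close> then gives \<open>(e, l)\<close>. So
    \<open>l\<close> is the \<open>(1 - e)\<close>-corner component of \<open>n\<close>.\<close>
  define k where "k = n \<ominus> n \<otimes> e"
  have k: "k \<in> carrier R" "k \<otimes> e = \<zero>"
    using c ee by (auto simp: k_def minus_eq l_distr l_minus m_assoc r_neg)
  define l where "l = k \<ominus> e \<otimes> k"
  have l: "l \<in> carrier R" "l \<otimes> e = \<zero>" "e \<otimes> l = \<zero>"
    using c k ee
    by (simp_all add: l_def minus_eq l_distr l_minus r_distr r_minus m_assoc r_neg)
       (simp add: r_neg flip: m_assoc)
  obtain v where vU: "v \<in> Units R" and v: "e \<otimes> v = e" "v \<otimes> e = e" "l \<otimes> v \<otimes> l = l"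
    using unit_regular_corner[OF ur c(1) ee l(1,3,2)] by blast
  have vc: "v \<in> carrier R" using vU by (rule Units_closed)
  \<comment> \<open>Idempotent by \<open>l v l = l\<close>, and orthogonal to \<open>e\<close>
    because \<open>e v = e\<close>. Since also \<open>v e = e\<close>, the unit
    \<open>(v, \<zero>)\<close> takes \<open>(e, l)\<close> to \<open>(e, g)\<close>.\<close>
  define g where "g = v \<otimes> l"
  have g: "g \<in> carrier R" using vc l by (simp add: g_def)
  have gg: "g \<otimes> g = g" using vc l v by (simp add: g_def m_assoc)
  have ge: "g \<otimes> e = \<zero>" using vc l c by (simp add: g_def m_assoc)
  have eg: "e \<otimes> g = \<zero>" using vc l c v by (simp add: g_def flip: m_assoc)
  define h where "h = \<one> \<ominus> (e \<oplus> g)"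
  have h: "h \<in> carrier R" "e \<oplus> g \<oplus> h = \<one>" using c g unfolding h_def by (simp, algebra)
  have eh: "e \<otimes> h = \<zero>" using c g ee eg by (simp add: h_def minus_eq r_distr r_minus r_neg)
  have gh: "g \<otimes> h = \<zero>" using c g gg ge by (simp add: h_def minus_eq r_distr r_minus r_neg)
  have he: "h \<otimes> e = \<zero>" using c g ee ge by (simp add: h_def minus_eq l_distr l_minus r_neg)
  have hg: "h \<otimes> g = \<zero>" using c g gg eg by (simp add: h_def minus_eq l_distr l_minus r_neg)
  have hh: "h \<otimes> h = h"
    using arg_cong[OF h(2), of "\<lambda>x. x \<otimes> h"] c g h(1) eh gh by (simp add: l_distr)
  have pair: "annihilator_pair S (e, g) (h, g)"
    using c g h ee gg hh eg ge eh he gh hg by (intro annihilator_pair_idempotents) auto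
  let ?u = "((v, \<zero>) \<otimes>\<^bsub>S\<^esub> (\<one>, \<ominus> n)) \<otimes>\<^bsub>S\<^esub> (u, \<zero>)" and ?v = "(\<one>, \<ominus> k)"
  have U: "?u \<in> Units S" "?v \<in> Units S"
    using uU vU c k by (auto simp del: S_simps(2) intro!: S.Units_m_closed Units_S_diag Units_S_unipotent)
  \<comment> \<open>This bracketing lets the reductions be evaluated from the inside, one unit at a
    time.\<close>
  have assoc: "p \<otimes>\<^bsub>S\<^esub> q \<otimes>\<^bsub>S\<^esub> r \<otimes>\<^bsub>S\<^esub> x \<otimes>\<^bsub>S\<^esub> y = p \<otimes>\<^bsub>S\<^esub> (q \<otimes>\<^bsub>S\<^esub> (r \<otimes>\<^bsub>S\<^esub> x) \<otimes>\<^bsub>S\<^esub> y)"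
    if "p \<in> carrier S" "q \<in> carrier S" "r \<in> carrier S" "x \<in> carrier S" "y \<in> carrier S" for p q r x y
    using that by (simp add: S.m_assoc del: S_simps)
  have "?u \<otimes>\<^bsub>S\<^esub> \<alpha> \<otimes>\<^bsub>S\<^esub> ?v =
      (v, \<zero>) \<otimes>\<^bsub>S\<^esub> ((\<one>, \<ominus> n) \<otimes>\<^bsub>S\<^esub> ((u, \<zero>) \<otimes>\<^bsub>S\<^esub> (a, m)) \<otimes>\<^bsub>S\<^esub> (\<one>, \<ominus> k))"
    unfolding \<alpha> using am u vc c k by (intro assoc) simp_all
  also have "(u, \<zero>) \<otimes>\<^bsub>S\<^esub> (a, m) = (e, n)" using u am by (simp add: e_def n_def)
  also have "(\<one>, \<ominus> n) \<otimes>\<^bsub>S\<^esub> (e, n) = (e, k)" using c by (simp add: k_def se minus_eq l_minus)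
  also have "(e, k) \<otimes>\<^bsub>S\<^esub> (\<one>, \<ominus> k) = (e, l)" using c k by (simp add: l_def minus_eq r_minus a_comm)
  also have "(v, \<zero>) \<otimes>\<^bsub>S\<^esub> (e, l) = (e, g)" using c l v vc by (simp add: g_def)
  finally have "?u \<otimes>\<^bsub>S\<^esub> \<alpha> \<otimes>\<^bsub>S\<^esub> ?v = (e, g)" .
  moreover have "left_morphic_element S (e, g)"
    using S.left_morphic_element_iff[of "(e, g)"] pair c g h by auto
  ultimately show "left_morphic_element S \<alpha>"
    using S.left_morphic_element_unit_mult[OF _ _ U, of \<alpha>] am \<alpha> by simp
qed

section \<open>From left morphic to unit regular\<close>

text \<open>The left ideal of \<open>(\<zero>, a)\<close> is \<open>0 \<times> R a\<close> and its
  left annihilator is \<open>l(a) \<times> R\<close>; both are compared with those of a partner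
  \<open>(b, c)\<close>. The last two conclusions say that \<open>r \<mapsto> r c\<close> induces an
  isomorphism from \<open>l(b)\<close> onto \<open>R / R \<sigma>(b)\<close>; surjectivity comes
  from \<open>(\<zero>, \<one>)\<close> killing \<open>(\<zero>, a)\<close>.\<close>

lemma annihilator_pair_nilpotent:
  assumes S: "left_morphic_ring S" and a: "a \<in> carrier R"
  obtains b c where "b \<in> carrier R" "c \<in> carrier R"
    and "PIdl a = left_annihilator R (\<sigma> b)" and "PIdl b = left_annihilator R a"
    and "\<exists>t\<in>carrier R. \<exists>z\<in>carrier R. t \<otimes> b = \<zero> \<and> t \<otimes> c \<oplus> z \<otimes> \<sigma> b = \<one>"
    and "\<And>r n. \<lbrakk>r \<in> carrier R; n \<in> carrier R; r \<otimes> b = \<zero>; r \<otimes> c \<oplus> n \<otimes> \<sigma> b = \<zero>\<rbrakk> \<Longrightarrow> r = \<zero>"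
proof -
  have "left_morphic_element S (\<zero>, a)" using S a by (simp add: left_morphic_ring_def)
  then obtain b c where bc: "b \<in> carrier R" "c \<in> carrier R"
    and P: "annihilator_pair S (\<zero>, a) (b, c)"
    using S.left_morphic_element_iff[of "(\<zero>, a)"] a by auto
  have P1: "r \<otimes> b = \<zero> \<and> r \<otimes> c \<oplus> n \<otimes> \<sigma> b = \<zero> \<longleftrightarrow> r = \<zero> \<and> (\<exists>s\<in>carrier R. n = s \<otimes> a)"
    if "r \<in> carrier R" "n \<in> carrier R" for r n
  proof -
    have "r \<otimes> b = \<zero> \<and> r \<otimes> c \<oplus> n \<otimes> \<sigma> b = \<zero> \<longleftrightarrow> (r, n) \<in> left_annihilator S (b, c)"
      using that by (simp add: left_annihilator_def)
    also have "\<dots> \<longleftrightarrow> (r, n) \<in> PIdl\<^bsub>S\<^esub> (\<zero>, a)" using P by (simp add: annihilator_pair_def)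
    also have "\<dots> \<longleftrightarrow> r = \<zero> \<and> (\<exists>s\<in>carrier R. n = s \<otimes> a)"
      using a by (auto simp: mem_PIdl_S)
    finally show ?thesis .
  qed
  have P2: "r \<otimes> a = \<zero> \<longleftrightarrow> (\<exists>s\<in>carrier R. \<exists>t\<in>carrier R. r = s \<otimes> b \<and> n = s \<otimes> c \<oplus> t \<otimes> \<sigma> b)"
    if "r \<in> carrier R" "n \<in> carrier R" for r n
  proof -
    have "r \<otimes> a = \<zero> \<longleftrightarrow> (r, n) \<in> left_annihilator S (\<zero>, a)"
      using that a by (simp add: left_annihilator_def)
    also have "\<dots> \<longleftrightarrow> (r, n) \<in> PIdl\<^bsub>S\<^esub> (b, c)" using P by (simp add: annihilator_pair_def)
    finally show ?thesis by (simp add: mem_PIdl_S)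
  qed
  show thesis
  proof (rule that[OF bc])
    show "PIdl a = left_annihilator R (\<sigma> b)"
      using P1[OF zero_closed] a bc by (auto simp: cgenideal_def left_annihilator_def)
    have "x \<in> PIdl b \<longleftrightarrow> x \<in> left_annihilator R a" for x
    proof
      assume "x \<in> PIdl b"
      then obtain s where s: "s \<in> carrier R" "x = s \<otimes> b" by (auto simp: cgenideal_def)
      \<comment> \<open>The second component in \<open>P2\<close> is arbitrary;
        \<open>s \<otimes> c\<close> is the one reached with \<open>t = \<zero>\<close>.\<close>
      have "\<exists>s'\<in>carrier R. \<exists>t\<in>carrier R. x = s' \<otimes> b \<and> s \<otimes> c = s' \<otimes> c \<oplus> t \<otimes> \<sigma> b"
        using s bc by (intro bexI[of _ s] bexI[of _ \<zero>]) auto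
      then show "x \<in> left_annihilator R a"
        using P2[of x "s \<otimes> c"] s bc by (simp add: left_annihilator_def)
    next
      assume "x \<in> left_annihilator R a"
      then show "x \<in> PIdl b"
        using P2[of x \<zero>] by (auto simp: left_annihilator_def cgenideal_def)
    qed
    then show "PIdl b = left_annihilator R a" by blast
    show "\<exists>t\<in>carrier R. \<exists>z\<in>carrier R. t \<otimes> b = \<zero> \<and> t \<otimes> c \<oplus> z \<otimes> \<sigma> b = \<one>"
      using P2[of \<zero> \<one>] a by (metis one_closed zero_closed l_null)
    show "r = \<zero>" if "r \<in> carrier R" "n \<in> carrier R" "r \<otimes> b = \<zero>" "r \<otimes> c \<oplus> n \<otimes> \<sigma> b = \<zero>" for r n
      using P1[of r n] that by simp
  qed
qed

lemma left_morphic_imp_regular: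
  assumes S: "left_morphic_ring S" and a: "a \<in> carrier R"
  shows "\<exists>y\<in>carrier R. a \<otimes> y \<otimes> a = a"
proof -
  obtain b c where bc: "b \<in> carrier R" "c \<in> carrier R"
    and P: "PIdl a = left_annihilator R (\<sigma> b)"
    and tz: "\<exists>t\<in>carrier R. \<exists>z\<in>carrier R. t \<otimes> b = \<zero> \<and> t \<otimes> c \<oplus> z \<otimes> \<sigma> b = \<one>"
    and inj: "\<And>r n. \<lbrakk>r \<in> carrier R; n \<in> carrier R; r \<otimes> b = \<zero>; r \<otimes> c \<oplus> n \<otimes> \<sigma> b = \<zero>\<rbrakk> \<Longrightarrow> r = \<zero>"
    using annihilator_pair_nilpotent[OF S a] by metis
  from tz obtain t z where tz: "t \<in> carrier R" "z \<in> carrier R" "t \<otimes> b = \<zero>"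
    and 1: "t \<otimes> c \<oplus> z \<otimes> \<sigma> b = \<one>" by blast
  define d where "d = \<sigma> b"
  have d: "d \<in> carrier R" using bc by (simp add: d_def)
  have "d \<otimes> (t \<otimes> c \<oplus> z \<otimes> d) = d" using 1 d by (simp add: d_def)
  then have dsum: "d \<otimes> t \<otimes> c \<oplus> d \<otimes> z \<otimes> d = d" using d tz bc by (simp add: r_distr m_assoc)
  \<comment> \<open>Since \<open>d t\<close> kills \<open>b\<close> and \<open>d t c\<close> lies in
    \<open>R d\<close>, injectivity forces \<open>d t = \<zero>\<close>, which leaves
    \<open>d z d = d\<close>.\<close>
  have "d \<otimes> t \<otimes> c \<oplus> (d \<otimes> z \<ominus> \<one>) \<otimes> d = (d \<otimes> t \<otimes> c \<oplus> d \<otimes> z \<otimes> d) \<ominus> d"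
    using d tz bc by (simp add: minus_eq l_distr l_minus a_assoc)
  also have "\<dots> = \<zero>" unfolding dsum using d by (simp add: minus_eq r_neg)
  finally have dt: "d \<otimes> t = \<zero>"
    using inj[of "d \<otimes> t" "d \<otimes> z \<ominus> \<one>"] d tz bc by (simp add: m_assoc flip: d_def)
  have dzd: "d \<otimes> z \<otimes> d = d" using dsum dt d tz bc by simp
  have ad: "a \<otimes> d = \<zero>"
    using P a cgenideal_self[OF a] by (simp add: left_annihilator_def d_def)
  \<comment> \<open>Regularity passes from \<open>d\<close> to \<open>a\<close>: the element
    \<open>\<one> \<ominus> d \<otimes> z\<close> of \<open>l(d) = R a\<close> has the form
    \<open>y a\<close>, and \<open>a d = \<zero>\<close> then gives
    \<open>a y a = a\<close>.\<close>
  have "\<one> \<ominus> d \<otimes> z \<in> left_annihilator R d"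
    using d tz dzd by (simp add: left_annihilator_def minus_eq l_distr l_minus r_neg)
  then obtain y where y: "y \<in> carrier R" "\<one> \<ominus> d \<otimes> z = y \<otimes> a"
    using P by (auto simp: cgenideal_def d_def set_eq_iff)
  have "a \<otimes> y \<otimes> a = a \<otimes> (\<one> \<ominus> d \<otimes> z)" using y a by (simp add: m_assoc)
  also have "\<dots> = a" using a d tz ad by (simp add: minus_eq r_distr r_minus flip: m_assoc)
  finally show ?thesis using y by blast
qed

lemma unit_regular_if_left_morphic_S:
  assumes S: "left_morphic_ring S"
  shows "unit_regular_ring R"
  unfolding unit_regular_ring_def
proof
  fix a assume a: "a \<in> carrier R"
  obtain b where b: "b \<in> carrier R" and P: "PIdl a = left_annihilator R (\<sigma> b)" "PIdl b = left_annihilator R a"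
    using annihilator_pair_nilpotent[OF S a] by metis
  obtain y where y: "y \<in> carrier R" "a \<otimes> y \<otimes> a = a" using left_morphic_imp_regular[OF S a] by blast
  obtain x where x: "x \<in> carrier R" "b \<otimes> x \<otimes> b = b" using left_morphic_imp_regular[OF S b] by blast
  have "\<sigma> (b \<otimes> x) = b \<otimes> x"
    using b x by (intro fixes_idem) (simp_all flip: m_assoc)
  then have bx: "\<sigma> b \<otimes> \<sigma> x = b \<otimes> x" using b x by simp
  have "\<sigma> (b \<otimes> x \<otimes> b) = b \<otimes> x \<otimes> \<sigma> b" using b x(1) bx by simp
  then have sb: "b \<otimes> x \<otimes> \<sigma> b = \<sigma> b" by (simp add: x(2))
  \<comment> \<open>By \<open>sb\<close> and \<open>bx\<close>, each of \<open>b\<close> and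
    \<open>\<sigma> b\<close> is a right multiple of the other:
    \<open>\<sigma> b = b x \<sigma>(b)\<close> and
    \<open>b = \<sigma>(b) \<sigma>(x) b\<close>.\<close>
  have "r \<otimes> \<sigma> b = \<zero> \<longleftrightarrow> r \<otimes> b = \<zero>" if r: "r \<in> carrier R" for r
  proof
    assume "r \<otimes> b = \<zero>"
    then have "r \<otimes> b \<otimes> (x \<otimes> \<sigma> b) = \<zero>" using b x by simp
    then show "r \<otimes> \<sigma> b = \<zero>" using sb r b x by (simp add: m_assoc)
  next
    assume "r \<otimes> \<sigma> b = \<zero>"
    then have "r \<otimes> \<sigma> b \<otimes> (\<sigma> x \<otimes> b) = \<zero>" using b x by simp
    then have "r \<otimes> (\<sigma> b \<otimes> \<sigma> x \<otimes> b) = \<zero>" using r b x by (simp add: m_assoc)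
    then show "r \<otimes> b = \<zero>" unfolding bx x(2) .
  qed
  then have "left_annihilator R (\<sigma> b) = left_annihilator R b"
    by (auto simp: left_annihilator_def)
  then have "annihilator_pair R a b" using P by (simp add: annihilator_pair_def)
  then show "\<exists>u\<in>Units R. a = a \<otimes> u \<otimes> a"
    using annihilator_pair_imp_unit_regular a b y by blast
qed

end

theorem corollary2p18:
  fixes R :: "('a, 'm) ring_scheme" and \<sigma> :: "'a \<Rightarrow> 'a"
  assumes "ring R"
    and "\<sigma> \<in> ring_hom R R"
    and "\<And>e. e \<in> carrier R \<Longrightarrow> e \<otimes>\<^bsub>R\<^esub> e = e \<Longrightarrow> \<sigma> e = e"
  shows "left_morphic_ring (trivial_extension R (twisted_bimodule R \<sigma>)) \<longleftrightarrow> unit_regular_ring R"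
proof -
  interpret ring R by fact
  interpret twisted_extension R \<sigma> "trivial_extension R (twisted_bimodule R \<sigma>)"
    by unfold_locales (use assms in auto)
  show ?thesis using left_morphic_S unit_regular_if_left_morphic_S by blast
qed

end
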